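(* Let $d>4$ be an integer. Let $A,B\in\mathbb{C}^{d\times d}$ satisfy $\operatorname{Tr}A=\operatorname{Tr}B=0$ and $\operatorname{Tr}A^\dagger A+\operatorname{Tr}B^\dagger B=\frac1d$, and suppose that $X=A\otimes I_d+I_d\otimes B$ is a normal matrix. Let $\sigma_1\ge\sigma_2\ge\cdots\ge\sigma_{d^2}$ be the singular values of $X$. Then $\sigma_1^2+\sigma_2^2\le\frac12$. (Equivalently, the supremum of $\sigma_1^2+\sigma_2^2$ over all such normal $X$ is at most $\frac12$.)
   Context: $A^\dagger$ denotes the conjugate transpose of $A$, $\otimes$ the Kronecker product, and $I_d$ the $d\times d$ identity matrix. Singular values are counted with multiplicity. *)

theory Defs
  imports
    "Jordan_Normal_Form.Schur_Decomposition"
    "Jordan_Normal_Form.Spectral_Radius"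
    "HOL-Library.Multiset"
    "HOL-Computational_Algebra.Fundamental_Theorem_Algebra"
begin

definition mat_trace :: "'a :: comm_monoid_add mat \<Rightarrow> 'a" where
  "mat_trace A = (\<Sum>i<dim_row A. A $$ (i, i))"

definition kronecker :: "'a :: times mat \<Rightarrow> 'a mat \<Rightarrow> 'a mat" where
  "kronecker A B =
     mat (dim_row A * dim_row B) (dim_col A * dim_col B)
       (\<lambda>(i, j). A $$ (i div dim_row B, j div dim_col B) * B $$ (i mod dim_row B, j mod dim_col B))"

definition normal_mat :: "complex mat \<Rightarrow> bool" where
  "normal_mat X \<longleftrightarrow> square_mat X \<and> X * mat_adjoint X = mat_adjoint X * X"

text \<open>
  The singular values are the square roots of the eigenvalues of \<open>X\<^sup>\<dagger>X\<close>, repeated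
  according to multiplicity (as roots of the characteristic polynomial) and listed in
  decreasing order; the list is indexed from 0. The eigenvalues of \<open>X\<^sup>\<dagger>X\<close> are
  nonnegative reals, so \<^const>\<open>Re\<close> only changes their type, as shown below.
\<close>

definition singular_values :: "complex mat \<Rightarrow> real list" where
  "singular_values X =
     rev (sorted_list_of_multiset
       (image_mset (\<lambda>z. sqrt (Re z)) (proots (char_poly (mat_adjoint X * X)))))"

lemma index_mat_adjoint:
  "i < dim_col A \<Longrightarrow> j < dim_row A \<Longrightarrow> mat_adjoint A $$ (i, j) = conjugate (A $$ (j, i))"
  by (simp add: mat_adjoint_def mat_of_rows_def)

lemma dim_mat_adjoint [simp]:
  "dim_row (mat_adjoint A) = dim_col A" "dim_col (mat_adjoint A) = dim_row A"
  by (simp_all add: mat_adjoint_def)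

lemma length_singular_values: "length (singular_values X) = dim_col X"
proof -
  have "mat_adjoint X * X \<in> carrier_mat (dim_col X) (dim_col X)"
    by auto
  from degree_monic_char_poly[OF this] have "size (proots (char_poly (mat_adjoint X * X))) = dim_col X"
    by (simp add: size_proots_complex)
  then show ?thesis
    by (metis length_rev mset_sorted_list_of_multiset singular_values_def size_image_mset size_mset)
qed

lemma singular_values_decreasing: "sorted_wrt (\<ge>) (singular_values X)"
  by (simp add: singular_values_def sorted_wrt_rev)

lemma eigenvalue_adjoint_mult_self:
  assumes "z \<in># proots (char_poly (mat_adjoint X * X))"
  shows "z \<in> \<real>" "Re z \<ge> 0"
proof -
  let ?n = "dim_col X" and ?M = "mat_adjoint X * X"
  have M: "?M \<in> carrier_mat ?n ?n"
    by auto
  have "char_poly ?M \<noteq> 0"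
    using degree_monic_char_poly[OF M] by auto
  with assms have "poly (char_poly ?M) z = 0"
    by simp
  then have "eigenvalue ?M z"
    using eigenvalue_root_char_poly[OF M] by simp
  then obtain v where v: "v \<in> carrier_vec ?n" "v \<noteq> 0\<^sub>v ?n" and Mv: "?M *\<^sub>v v = z \<cdot>\<^sub>v v"
    using M unfolding eigenvalue_def eigenvector_def by auto
  define w where "w = X *\<^sub>v v"
  have "(?M *\<^sub>v v) \<bullet>c v = w \<bullet>c w"
  proof -
    have "?M *\<^sub>v v = mat_adjoint X *\<^sub>v w"
      unfolding w_def using v(1) by (intro assoc_mult_mat_vec) auto
    then have "(?M *\<^sub>v v) \<bullet>c v =
        (\<Sum>i<?n. (\<Sum>j<dim_row X. cnj (X $$ (j, i)) * w $ j) * cnj (v $ i))"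
      using v(1)
      by (simp add: scalar_prod_def w_def index_mat_adjoint lessThan_atLeast0)
    also have "\<dots> = (\<Sum>j<dim_row X. w $ j * cnj (\<Sum>i<?n. X $$ (j, i) * v $ i))"
      by (simp add: sum_distrib_left sum_distrib_right mult_ac) (rule sum.swap)
    also have "\<dots> = w \<bullet>c w"
      using v(1) by (simp add: scalar_prod_def w_def lessThan_atLeast0)
    finally show ?thesis .
  qed
  moreover have "(?M *\<^sub>v v) \<bullet>c v = z * (v \<bullet>c v)"
    using v(1) by (simp add: Mv)
  ultimately have eq: "z * (v \<bullet>c v) = w \<bullet>c w"
    by simp
  have pos: "v \<bullet>c v > 0"
    using v by (simp add: conjugate_square_greater_0_vec)
  have "w \<bullet>c w \<ge> 0"
    by (rule conjugate_square_ge_0_vec)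
  moreover have "z = (w \<bullet>c w) / (v \<bullet>c v)"
    using eq pos by (metis less_irrefl nonzero_mult_div_cancel_right)
  ultimately show "z \<in> \<real>" "Re z \<ge> 0"
    using pos by (auto simp: less_eq_complex_def less_complex_def complex_is_Real_iff Re_divide Im_divide)
qed

end

theory Submission
  imports
    Defs
    "HOL-Analysis.Convex"
    "HOL-Combinatorics.List_Permutation"
begin

text \<open>Comparing the entries of \<open>X X\<^sup>\<dagger>\<close> and \<open>X\<^sup>\<dagger> X\<close> shows that the self-commutators of \<open>A\<close> and \<open>B\<close> are
  scalar matrices; having trace zero they vanish, so \<open>A\<close> and \<open>B\<close> are normal. After unitary
  diagonalization the singular values of \<open>X\<close> are the numbers \<open>\<bar>a\<^sub>i + b\<^sub>j\<bar>\<close>, and the claim concerns two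
  distinct index pairs. If both components differ, the bound \<open>2 / d\<close> is immediate; if they share
  one, the zero-sum conditions and a weighted Cauchy--Schwarz inequality give
  \<open>(3 d - 4) / d\<^sup>2\<close>.\<close>

section \<open>Adjoints and unitary matrices\<close>

lemma mat_adjoint_carrier [simp]: "A \<in> carrier_mat n m \<Longrightarrow> mat_adjoint A \<in> carrier_mat m n"
  by auto

lemma mat_adjoint_adjoint [simp]:
  fixes A :: "complex mat"
  shows "mat_adjoint (mat_adjoint A) = A"
  by (rule eq_matI) (auto simp: index_mat_adjoint)

lemma mat_adjoint_mult:
  fixes A B :: "complex mat"
  assumes "A \<in> carrier_mat n m" "B \<in> carrier_mat m l"
  shows "mat_adjoint (A * B) = mat_adjoint B * mat_adjoint A"
  by (rule eq_matI)
    (use assms in \<open>auto simp: index_mat_adjoint scalar_prod_def mult.commute\<close>)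

lemma mat_adjoint_add:
  fixes A B :: "complex mat"
  assumes "A \<in> carrier_mat n m" "B \<in> carrier_mat n m"
  shows "mat_adjoint (A + B) = mat_adjoint A + mat_adjoint B"
  by (rule eq_matI) (use assms in \<open>auto simp: index_mat_adjoint\<close>)

lemma mat_adjoint_one [simp]: "mat_adjoint (1\<^sub>m n) = (1\<^sub>m n :: complex mat)"
  by (rule eq_matI) (auto simp: index_mat_adjoint)

lemma mat_adjoint_zero [simp]: "mat_adjoint (0\<^sub>m n m) = (0\<^sub>m m n :: complex mat)"
  by (rule eq_matI) (auto simp: index_mat_adjoint)

lemma mat_adjoint_diag: "mat_adjoint (mat_diag n a) = mat_diag n (\<lambda>i. cnj (a i))"
  by (rule eq_matI) (auto simp: index_mat_adjoint mat_diag_def)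

section \<open>Block matrices\<close>

lemma mat_adjoint_four_block:
  fixes A B C D :: "complex mat"
  assumes "A \<in> carrier_mat nr1 nc1" "B \<in> carrier_mat nr1 nc2"
    "C \<in> carrier_mat nr2 nc1" "D \<in> carrier_mat nr2 nc2"
  shows "mat_adjoint (four_block_mat A B C D) =
    four_block_mat (mat_adjoint A) (mat_adjoint C) (mat_adjoint B) (mat_adjoint D)"
  by (rule eq_matI) (use assms in \<open>auto simp: index_mat_adjoint\<close>)

lemma mult_four_block_diag_mat:
  fixes A B C D :: "complex mat"
  assumes "A \<in> carrier_mat n n" "B \<in> carrier_mat m m" "C \<in> carrier_mat n n" "D \<in> carrier_mat m m"
  shows "four_block_mat A (0\<^sub>m n m) (0\<^sub>m m n) B * four_block_mat C (0\<^sub>m n m) (0\<^sub>m m n) D =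
    four_block_mat (A * C) (0\<^sub>m n m) (0\<^sub>m m n) (B * D)"
  using assms
  by (subst mult_four_block_mat[of _ n n _ m _ m _ _ n _ m])
    (auto simp: left_mult_zero_mat[of _ n] left_mult_zero_mat[of _ m] right_mult_zero_mat[of _ _ n]
      right_mult_zero_mat[of _ _ m] left_add_zero_mat[of _ n] right_add_zero_mat[of _ m])

text \<open>Both one-sided identities are recorded, so that passing to the adjoint preserves the
  notion by symmetry. As the matrices are square, \<open>unitaryI\<close> obtains the second
  identity from the first.\<close>

definition unitary :: "nat \<Rightarrow> complex mat \<Rightarrow> bool" where
  "unitary n U \<longleftrightarrow> U \<in> carrier_mat n n \<and> mat_adjoint U * U = 1\<^sub>m n \<and> U * mat_adjoint U = 1\<^sub>m n"

lemma unitaryD: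
  assumes "unitary n U"
  shows "U \<in> carrier_mat n n" "mat_adjoint U * U = 1\<^sub>m n" "U * mat_adjoint U = 1\<^sub>m n"
  using assms by (auto simp: unitary_def)

lemma unitaryI:
  assumes "U \<in> carrier_mat n n" "mat_adjoint U * U = 1\<^sub>m n"
  shows "unitary n U"
  using assms mat_mult_left_right_inverse[of "mat_adjoint U" n U] by (simp add: unitary_def)

text \<open>The products are nested to the right because rewriting with associativity leaves them in
  that form.\<close>

lemma unitary_cancel:
  assumes "unitary n U" "M \<in> carrier_mat n k"
  shows "mat_adjoint U * (U * M) = M" "U * (mat_adjoint U * M) = M"
proof -
  note U = unitaryD[OF assms(1)]
  have "mat_adjoint U * (U * M) = mat_adjoint U * U * M"
    using U(1) assms(2) by (intro assoc_mult_mat[symmetric]) auto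
  then show "mat_adjoint U * (U * M) = M"
    using U assms(2) by simp
  have "U * (mat_adjoint U * M) = U * mat_adjoint U * M"
    using U(1) assms(2) by (intro assoc_mult_mat[symmetric]) auto
  then show "U * (mat_adjoint U * M) = M"
    using U assms(2) by simp
qed

lemma unitary_mult:
  assumes "unitary n U" "unitary n V"
  shows "unitary n (U * V)"
proof (rule unitaryI)
  note U = unitaryD[OF assms(1)] and V = unitaryD[OF assms(2)]
  show "U * V \<in> carrier_mat n n"
    using U V by simp
  have "mat_adjoint (U * V) * (U * V) = mat_adjoint V * (mat_adjoint U * (U * V))"
    using U(1) V(1) by (simp add: mat_adjoint_mult[OF U(1) V(1)] assoc_mult_mat[of _ n n _ n _ n])
  then show "mat_adjoint (U * V) * (U * V) = 1\<^sub>m n"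
    using V by (simp add: unitary_cancel[OF assms(1) V(1)])
qed

lemma unitary_adjoint: "unitary n U \<Longrightarrow> unitary n (mat_adjoint U)"
  by (auto simp: unitary_def)

text \<open>The inner factor \<open>mat_adjoint U * U\<close> cancels. Together with
  \<open>adjoint_unitary_conj\<close> this reduces computations with conjugated matrices, such as
  \<open>mat_adjoint X * X\<close>, to the matrices in the middle.\<close>

lemma unitary_conj_mult:
  assumes U: "unitary n U" and M: "M \<in> carrier_mat n n" and N: "N \<in> carrier_mat n n"
  shows "(U * M * mat_adjoint U) * (U * N * mat_adjoint U) = U * (M * N) * mat_adjoint U"
proof -
  note Ud = unitaryD[OF U]
  have "(U * M * mat_adjoint U) * (U * N * mat_adjoint U)
      = U * (M * (mat_adjoint U * (U * (N * mat_adjoint U))))"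
    using Ud(1) M N by (simp add: assoc_mult_mat[of _ n n _ n _ n])
  also have "mat_adjoint U * (U * (N * mat_adjoint U)) = N * mat_adjoint U"
    using Ud(1) N by (intro unitary_cancel[OF U, of _ n]) auto
  finally show ?thesis
    using Ud(1) M N by (simp add: assoc_mult_mat[of _ n n _ n _ n])
qed

lemma adjoint_unitary_conj:
  assumes U: "unitary n U" and M: "M \<in> carrier_mat n n"
  shows "mat_adjoint (U * M * mat_adjoint U) = U * mat_adjoint M * mat_adjoint U"
proof -
  note Ud = unitaryD(1)[OF U]
  show ?thesis
    using Ud M
    by (simp add: mat_adjoint_mult[of _ n n _ n] assoc_mult_mat[of _ n n _ n _ n])
qed

lemma normal_mat_unitary_conj:
  assumes U: "unitary n U" and M: "M \<in> carrier_mat n n" and N: "normal_mat M"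
  shows "normal_mat (U * M * mat_adjoint U)"
proof -
  have "mat_adjoint M \<in> carrier_mat n n"
    using M by simp
  moreover have "M * mat_adjoint M = mat_adjoint M * M"
    using N by (simp add: normal_mat_def)
  moreover have "square_mat (U * M * mat_adjoint U)"
    using unitaryD(1)[OF U] by auto
  ultimately show ?thesis
    using U M by (simp add: normal_mat_def adjoint_unitary_conj unitary_conj_mult)
qed

section \<open>Cyclicity of the trace\<close>

lemma mat_trace_mult_commute:
  fixes P Q :: "complex mat"
  assumes "P \<in> carrier_mat n m" "Q \<in> carrier_mat m n"
  shows "mat_trace (P * Q) = mat_trace (Q * P)"
proof -
  have "mat_trace (P * Q) = (\<Sum>i<n. \<Sum>j<m. P $$ (i, j) * Q $$ (j, i))"
    using assms by (auto simp: mat_trace_def scalar_prod_def lessThan_atLeast0)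
  also have "\<dots> = (\<Sum>j<m. \<Sum>i<n. Q $$ (j, i) * P $$ (i, j))"
    by (subst sum.swap) (simp add: mult.commute)
  also have "\<dots> = mat_trace (Q * P)"
    using assms by (auto simp: mat_trace_def scalar_prod_def lessThan_atLeast0)
  finally show ?thesis .
qed

lemma mat_trace_unitary_conj:
  assumes U: "unitary n U" and M: "M \<in> carrier_mat n n"
  shows "mat_trace (U * M * mat_adjoint U) = mat_trace M"
proof -
  note Ud = unitaryD(1)[OF U]
  have "mat_trace (U * M * mat_adjoint U) = mat_trace (mat_adjoint U * (U * M))"
    using Ud M by (intro mat_trace_mult_commute[of _ n n]) auto
  then show ?thesis
    using M by (simp add: unitary_cancel[OF U, of _ n])
qed

section \<open>Spectral theorem for normal matrices\<close>

text \<open>Complete \<open>v\<close> to a basis, orthogonalize it by Gram-Schmidt, which keeps the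
  first vector, and normalize. The scalar \<open>c\<close> absorbs the normalization of
  \<open>v\<close>.\<close>

lemma unitary_extend_vec:
  fixes v :: "complex vec"
  assumes v: "v \<in> carrier_vec n" and v0: "v \<noteq> 0\<^sub>v n"
  obtains U c where "unitary n U" "col U 0 = c \<cdot>\<^sub>v v"
proof -
  interpret cof_vec_space n "TYPE(complex)" .
  define b where "b = basis_completion v"
  define ws where "ws = gram_schmidt n b"
  from v v0 have n: "n \<noteq> 0"
    by (metis carrier_vecD vec_of_dim_0)
  from basis_completion[OF v v0, folded b_def]
  have dist_b: "distinct b" and indep: "\<not> lin_dep (set b)" and b: "set b \<subseteq> carrier_vec n"
    and hdb: "hd b = v" and len_b: "length b = n"
    by auto
  from hdb len_b n obtain vs where bv: "b = v # vs"
    by (cases b) auto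
  from gram_schmidt_result[OF b dist_b indep refl, folded ws_def]
  have ws: "set ws \<subseteq> carrier_vec n" "corthogonal ws" "length ws = n"
    by (auto simp: len_b)
  have hdws: "ws ! 0 = v"
    using gram_schmidt_hd[OF v, of vs, folded bv] ws(3) n
    by (metis hd_conv_nth list.size(3) ws_def)
  have wsi: "ws ! i \<in> carrier_vec n" if "i < n" for i
    using ws that by auto
  \<comment> \<open>Gram-Schmidt yields orthogonal but not normalized vectors; \<open>r i\<close> is
    the reciprocal of the norm of \<open>ws ! i\<close>.\<close>
  define r where "r i = complex_of_real (1 / sqrt (Re (ws ! i \<bullet>c ws ! i)))" for i
  have cnj_r: "cnj (r i) = r i" for i
    by (simp add: r_def)
  define U where "U = mat n n (\<lambda>(i, j). r j * ws ! j $ i)"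
  have U: "U \<in> carrier_mat n n"
    by (simp add: U_def)
  have "mat_adjoint U * U = 1\<^sub>m n"
  proof (rule eq_matI)
    fix i j assume "i < dim_row (1\<^sub>m n :: complex mat)" "j < dim_col (1\<^sub>m n :: complex mat)"
    then have ij: "i < n" "j < n"
      by auto
    have "(mat_adjoint U * U) $$ (i, j) = r i * r j * (ws ! j \<bullet>c ws ! i)"
      using ij wsi[OF ij(1)] wsi[OF ij(2)]
      by (simp add: U_def index_mat_adjoint scalar_prod_def sum_distrib_left cnj_r mult_ac)
    also have "\<dots> = (if i = j then 1 else 0)"
    proof (cases "i = j")
      case False
      then show ?thesis
        using corthogonalD[OF ws(2), of j i] ij ws(3) by auto
    next
      case True
      have "ws ! i \<bullet>c ws ! i \<noteq> 0"
        using corthogonalD[OF ws(2), of i i] ij ws(3) by auto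
      moreover have "ws ! i \<bullet>c ws ! i \<ge> 0"
        by (rule conjugate_square_ge_0_vec)
      \<comment> \<open>Being nonnegative in the order on complex numbers includes being real, so
        the inner product is a positive real \<open>s\<close>.\<close>
      ultimately obtain s where s: "s > 0" "ws ! i \<bullet>c ws ! i = complex_of_real s"
        by (metis (no_types, lifting) complex_eqI complex_of_real_def less_eq_complex_def
          of_real_0 order_le_less complex_is_Real_iff zero_complex.simps of_real_Re)
      have "r i * r i = complex_of_real (1 / s)"
        using s(1) unfolding r_def s(2) of_real_mult[symmetric] by simp
      then show ?thesis
        using True s by simp
    qed
    finally show "(mat_adjoint U * U) $$ (i, j) = 1\<^sub>m n $$ (i, j)"
      using ij by simp
  qed (simp_all add: U_def)
  then have "unitary n U"
    using U by (intro unitaryI)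
  moreover have "col U 0 = r 0 \<cdot>\<^sub>v v"
    using n v hdws by (intro eq_vecI) (auto simp: U_def)
  ultimately show ?thesis
    using that by blast
qed


text \<open>Unitarily conjugating an eigenvector onto the first unit vector leaves only the eigenvalue in
  the first column; normality equates the norms of the first row and column, so the first row
  vanishes off the diagonal as well.\<close>

lemma normal_mat_unitary_split:
  assumes A: "A \<in> carrier_mat (Suc n) (Suc n)" and N: "normal_mat A"
  obtains W e B where "unitary (Suc n) W" "B \<in> carrier_mat n n" "normal_mat B"
    "A = W * four_block_mat (mat_diag 1 (\<lambda>_. e)) (0\<^sub>m 1 n) (0\<^sub>m n 1) B * mat_adjoint W"
proof -
  let ?n = "Suc n"
  have "spectrum A \<noteq> {}"
    using spectrum_non_empty[OF A] by simp
  then obtain e v where v: "v \<in> carrier_vec ?n" "v \<noteq> 0\<^sub>v ?n" and Av: "A *\<^sub>v v = e \<cdot>\<^sub>v v"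
    using A by (auto simp: spectrum_def eigenvalue_def eigenvector_def)
  obtain W c where W: "unitary ?n W" and colW: "col W 0 = c \<cdot>\<^sub>v v"
    using unitary_extend_vec[OF v] by blast
  note Wd = unitaryD[OF W]
  define M where "M = mat_adjoint W * A * W"
  have M: "M \<in> carrier_mat ?n ?n"
    using A Wd(1) by (auto simp: M_def)
  have AM: "A = W * M * mat_adjoint W"
  proof -
    have "W * M * mat_adjoint W = W * (mat_adjoint W * (A * (W * mat_adjoint W)))"
      using A Wd(1)
      by (simp add: M_def assoc_mult_mat[of _ ?n ?n _ ?n _ ?n] mult_carrier_mat[of _ ?n ?n])
    also have "\<dots> = A * (W * mat_adjoint W)"
      using A Wd(1) by (intro unitary_cancel[OF W, of _ ?n]) simp
    finally show ?thesis
      using A Wd(3) by simp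
  qed
  have NM: "normal_mat M"
    using normal_mat_unitary_conj[OF unitary_adjoint[OF W] A N] by (simp add: M_def)
  have "col (A * W) 0 = e \<cdot>\<^sub>v col W 0"
  proof -
    have "col (A * W) 0 = A *\<^sub>v col W 0"
      using A Wd(1) by (intro col_mult2) auto
    also have "\<dots> = c \<cdot>\<^sub>v (e \<cdot>\<^sub>v v)"
      using A v(1) by (simp add: colW mult_mat_vec Av)
    also have "\<dots> = e \<cdot>\<^sub>v col W 0"
      by (simp add: colW smult_smult_assoc mult.commute)
    finally show ?thesis .
  qed
  then have "col M 0 = mat_adjoint W *\<^sub>v (e \<cdot>\<^sub>v col W 0)"
    using A Wd(1) by (simp add: M_def assoc_mult_mat[of _ ?n ?n _ ?n _ ?n] col_mult2[of _ ?n ?n _ ?n])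
  also have "\<dots> = e \<cdot>\<^sub>v (mat_adjoint W *\<^sub>v col W 0)"
    using Wd(1) by (intro mult_mat_vec[of _ ?n ?n]) (auto intro: carrier_vecI)
  also have "mat_adjoint W *\<^sub>v col W 0 = col (mat_adjoint W * W) 0"
    using Wd(1) by (intro col_mult2[symmetric]) auto
  finally have "col M 0 = e \<cdot>\<^sub>v unit_vec ?n 0"
    by (simp add: Wd(2))
  then have col0: "M $$ (i, 0) = (if i = 0 then e else 0)" if "i < ?n" for i
    using that M by (metis (no_types, lifting) carrier_matD index_col index_smult_vec(1)
      index_unit_vec mult.right_neutral mult_zero_right zero_less_Suc)
  have "(M * mat_adjoint M) $$ (0, 0) = (mat_adjoint M * M) $$ (0, 0)"
    using NM by (simp add: normal_mat_def)
  then have "(\<Sum>j<?n. M $$ (0, j) * cnj (M $$ (0, j))) = (\<Sum>i<?n. cnj (M $$ (i, 0)) * M $$ (i, 0))"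
    using M by (simp add: scalar_prod_def index_mat_adjoint lessThan_atLeast0)
  also have "\<dots> = M $$ (0, 0) * cnj (M $$ (0, 0))"
    by (subst sum.lessThan_Suc_shift) (simp add: col0)
  finally have "(\<Sum>j<n. M $$ (0, Suc j) * cnj (M $$ (0, Suc j))) = 0"
    by (subst (asm) sum.lessThan_Suc_shift) simp
  then have "complex_of_real (\<Sum>j<n. (cmod (M $$ (0, Suc j)))\<^sup>2) = 0"
    by (simp only: complex_norm_square of_real_sum)
  then have row0: "M $$ (0, Suc j) = 0" if "j < n" for j
    using that unfolding of_real_eq_0_iff by (subst (asm) sum_nonneg_eq_0_iff) auto
  define B where "B = mat n n (\<lambda>(i, j). M $$ (Suc i, Suc j))"
  have B: "B \<in> carrier_mat n n"
    by (simp add: B_def)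
  let ?E = "mat_diag 1 (\<lambda>_. e)"
  have MB: "M = four_block_mat ?E (0\<^sub>m 1 n) (0\<^sub>m n 1) B"
  proof (rule eq_matI)
    fix i j
    assume "i < dim_row (four_block_mat ?E (0\<^sub>m 1 n) (0\<^sub>m n 1) B)"
      "j < dim_col (four_block_mat ?E (0\<^sub>m 1 n) (0\<^sub>m n 1) B)"
    then have ij: "i < ?n" "j < ?n"
      using B by (auto simp: mat_diag_def)
    then show "M $$ (i, j) = four_block_mat ?E (0\<^sub>m 1 n) (0\<^sub>m n 1) B $$ (i, j)"
      using B by (cases i; cases j) (auto simp: mat_diag_def B_def col0 row0)
  qed (use M B in \<open>auto simp: mat_diag_def\<close>)
  have adjM: "mat_adjoint M = four_block_mat (mat_adjoint ?E) (0\<^sub>m 1 n) (0\<^sub>m n 1) (mat_adjoint B)"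
    unfolding MB using B by (subst mat_adjoint_four_block[of _ 1 1 _ n _ n]) auto
  have "M * mat_adjoint M = four_block_mat (?E * mat_adjoint ?E) (0\<^sub>m 1 n) (0\<^sub>m n 1) (B * mat_adjoint B)"
    unfolding adjM unfolding MB using B
    by (subst mult_four_block_diag_mat) (auto simp: mat_adjoint_diag)
  moreover have "mat_adjoint M * M = four_block_mat (mat_adjoint ?E * ?E) (0\<^sub>m 1 n) (0\<^sub>m n 1) (mat_adjoint B * B)"
    unfolding adjM unfolding MB using B
    by (subst mult_four_block_diag_mat) (auto simp: mat_adjoint_diag)
  ultimately have eq: "four_block_mat (?E * mat_adjoint ?E) (0\<^sub>m 1 n) (0\<^sub>m n 1) (B * mat_adjoint B) =
      four_block_mat (mat_adjoint ?E * ?E) (0\<^sub>m 1 n) (0\<^sub>m n 1) (mat_adjoint B * B)"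
    using NM by (simp add: normal_mat_def)
  \<comment> \<open>Compare the lower right blocks; \<open>Suc\<close> skips the one row and column
    of the corner block.\<close>
  have "(B * mat_adjoint B) $$ (i, j) = (mat_adjoint B * B) $$ (i, j)" if "i < n" "j < n" for i j
    using arg_cong[OF eq, of "\<lambda>X. X $$ (Suc i, Suc j)"] that B
    by (simp add: mat_adjoint_diag mat_diag_def del: index_mult_mat(1))
  then have "normal_mat B"
    using B unfolding normal_mat_def by (intro conjI eq_matI) auto
  then show ?thesis
    using that[OF W B _ ] AM MB by blast
qed

text \<open>Induction on the size: split off one eigenvalue, diagonalize the smaller normal block by
  the induction hypothesis, and extend its unitary matrix by a 1 in the corner.\<close>

theorem normal_mat_unitary_diag:
  assumes "A \<in> carrier_mat n n" "normal_mat A"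
  shows "\<exists>U a. unitary n U \<and> A = U * mat_diag n a * mat_adjoint U"
  using assms
proof (induction n arbitrary: A)
  case 0
  then have "A = 1\<^sub>m 0 * mat_diag 0 (\<lambda>_. 0) * mat_adjoint (1\<^sub>m 0)"
    by (intro eq_matI) auto
  moreover have "unitary 0 (1\<^sub>m 0)"
    by (simp add: unitary_def)
  ultimately show ?case
    by blast
next
  case (Suc n)
  obtain W e B where W: "unitary (Suc n) W" and B: "B \<in> carrier_mat n n" "normal_mat B"
    and A: "A = W * four_block_mat (mat_diag 1 (\<lambda>_. e)) (0\<^sub>m 1 n) (0\<^sub>m n 1) B * mat_adjoint W"
    using normal_mat_unitary_split[OF Suc.prems] by blast
  obtain V b where V: "unitary n V" and BV: "B = V * mat_diag n b * mat_adjoint V"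
    using Suc.IH[OF B] by blast
  note Wd = unitaryD[OF W] and Vd = unitaryD[OF V]
  define V' where "V' = four_block_mat (1\<^sub>m 1) (0\<^sub>m 1 n) (0\<^sub>m n 1) V"
  \<comment> \<open>\<open>case_nat\<close> puts the new eigenvalue at position 0 and shifts the old
    ones up by one.\<close>
  define D where "D = mat_diag (Suc n) (case_nat e b)"
  have adjV': "mat_adjoint V' = four_block_mat (1\<^sub>m 1) (0\<^sub>m 1 n) (0\<^sub>m n 1) (mat_adjoint V)"
    unfolding V'_def using Vd(1) by (subst mat_adjoint_four_block[of _ 1 1 _ n _ n]) auto
  have V': "V' \<in> carrier_mat (Suc n) (Suc n)"
    using Vd(1) unfolding V'_def by auto
  have "mat_adjoint V' * V' = 1\<^sub>m (Suc n)"
    unfolding adjV' unfolding V'_def using Vd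
    by (subst mult_four_block_diag_mat) auto
  with V' have UV': "unitary (Suc n) V'"
    by (intro unitaryI)
  have D: "D = four_block_mat (mat_diag 1 (\<lambda>_. e)) (0\<^sub>m 1 n) (0\<^sub>m n 1) (mat_diag n b)"
    unfolding D_def by (rule eq_matI) (auto simp: mat_diag_def split: nat.splits)
  have "V' * D = four_block_mat (mat_diag 1 (\<lambda>_. e)) (0\<^sub>m 1 n) (0\<^sub>m n 1) (V * mat_diag n b)"
    unfolding D V'_def using Vd
    by (subst mult_four_block_diag_mat) (auto simp: left_mult_one_mat[OF mat_diag_dim])
  then have "V' * D * mat_adjoint V' = four_block_mat (mat_diag 1 (\<lambda>_. e)) (0\<^sub>m 1 n) (0\<^sub>m n 1) B"
    unfolding adjV' BV using Vd
    by (simp add: mult_four_block_diag_mat right_mult_one_mat[OF mat_diag_dim])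
  then have "A = W * (V' * D * mat_adjoint V') * mat_adjoint W"
    using A by simp
  also have "\<dots> = (W * V') * D * mat_adjoint (W * V')"
    using Wd(1) V' by (simp add: D_def mat_adjoint_mult[OF Wd(1) V']
      assoc_mult_mat[of _ "Suc n" "Suc n" _ "Suc n" _ "Suc n"]
      mult_carrier_mat[of _ "Suc n" "Suc n"])
  finally show ?case
    using unitary_mult[OF W UV'] unfolding D_def by blast
qed


text \<open>The matrix \<open>mat_adjoint X * X\<close> is similar to the diagonal matrix of the
  squared moduli of \<open>f\<close>, so these are the roots of its characteristic polynomial. Only
  multisets are compared, because \<open>singular_values\<close> is sorted while \<open>f\<close>
  comes in arbitrary order.\<close>

lemma singular_values_unitary_diag:
  assumes U: "unitary n U" and X: "X = U * mat_diag n f * mat_adjoint U"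
  shows "mset (singular_values X) = mset (map (\<lambda>p. cmod (f p)) [0..<n])"
proof -
  let ?D = "mat_diag n (\<lambda>p. cnj (f p) * f p)"
  note Ud = unitaryD[OF U]
  have XX: "mat_adjoint X * X = U * ?D * mat_adjoint U"
    unfolding X by (simp add: adjoint_unitary_conj[OF U] mat_adjoint_diag unitary_conj_mult[OF U])
  have "similar_mat (mat_adjoint X * X) ?D"
    using Ud XX by (intro similar_matI[of _ _ U "mat_adjoint U" n]) auto
  then have "char_poly (mat_adjoint X * X) = char_poly ?D"
    by (rule char_poly_similar)
  also have "\<dots> = (\<Prod>a\<leftarrow>diag_mat ?D. [:- a, 1:])"
    by (rule char_poly_upper_triangular[of _ n]) (auto simp: mat_diag_def)
  also have "diag_mat ?D = map (\<lambda>p. cnj (f p) * f p) [0..<n]"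
    by (auto simp: diag_mat_def mat_diag_def)
  \<comment> \<open>The linear factors are gathered in a mapped list so that
    \<open>proots_prod_list\<close> applies.\<close>
  finally have cp: "char_poly (mat_adjoint X * X) =
      (\<Prod>q\<leftarrow>map (\<lambda>p. [:- (cnj (f p) * f p), 1:]) [0..<n]. q)"
    by (simp add: o_def)
  have "proots (char_poly (mat_adjoint X * X)) = (\<Sum>p\<leftarrow>[0..<n]. {#cnj (f p) * f p#})"
    unfolding cp by (subst proots_prod_list) (auto simp: o_def)
  also have "\<dots> = mset (map (\<lambda>p. cnj (f p) * f p) [0..<n])"
    by (induction n) auto
  finally have "image_mset (\<lambda>z. sqrt (Re z)) (proots (char_poly (mat_adjoint X * X)))
      = mset (map (\<lambda>p. sqrt (Re (cnj (f p) * f p))) [0..<n])"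
    by (simp add: image_mset.compositionality o_def)
  also have "(\<lambda>p. sqrt (Re (cnj (f p) * f p))) = (\<lambda>p. cmod (f p))"
    by (simp add: cmod_def power2_eq_square)
  finally show ?thesis
    by (simp add: singular_values_def)
qed

section \<open>Kronecker products\<close>

lemma kronecker_carrier [simp]:
  "A \<in> carrier_mat n m \<Longrightarrow> B \<in> carrier_mat p q \<Longrightarrow> kronecker A B \<in> carrier_mat (n * p) (m * q)"
  by (auto simp: kronecker_def)

lemma mult_add_less_mult:
  fixes i k n p :: nat
  assumes "i < n" "k < p"
  shows "i * p + k < n * p"
proof -
  have "i * p + k < Suc i * p"
    using assms by simp
  also have "\<dots> \<le> n * p"
    using assms by (intro mult_right_mono) auto
  finally show ?thesis .
qed

lemma index_kronecker:
  assumes "A \<in> carrier_mat n m" "B \<in> carrier_mat p q" "r < n * p" "s < m * q"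
  shows "kronecker A B $$ (r, s) = A $$ (r div p, s div q) * B $$ (r mod p, s mod q)"
  using assms by (auto simp: kronecker_def)

lemma div_mod_bounds:
  fixes r n p :: nat
  assumes "r < n * p"
  shows "r div p < n" "r mod p < p"
  using assms by (auto simp: less_mult_imp_div_less) (metis mod_less_divisor mult_0_right neq0_conv not_less0)

text \<open>Division with remainder by \<open>p\<close> is a bijection from the indices below
  \<open>n * p\<close> to pairs of indices, with inverse \<open>i * p + k\<close>.\<close>

lemma sum_div_mod:
  fixes g :: "nat \<Rightarrow> nat \<Rightarrow> 'a :: comm_monoid_add"
  shows "(\<Sum>r<n * p. g (r div p) (r mod p)) = (\<Sum>i<n. \<Sum>k<p. g i k)"
  unfolding sum.cartesian_product
  by (rule sum.reindex_bij_witness[where i = "\<lambda>(i, k). i * p + k" and j = "\<lambda>r. (r div p, r mod p)"])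
    (auto simp: div_mod_bounds mult_add_less_mult)

text \<open>Mixed-product rule: once the summation index is split into quotient and remainder, the
  sum for an entry factors into two sums.\<close>

lemma kronecker_mult:
  fixes A B C D :: "complex mat"
  assumes A: "A \<in> carrier_mat n m" and C: "C \<in> carrier_mat m l"
    and B: "B \<in> carrier_mat p q" and D: "D \<in> carrier_mat q t"
  shows "kronecker A B * kronecker C D = kronecker (A * C) (B * D)"
proof (rule eq_matI)
  fix r s
  assume "r < dim_row (kronecker (A * C) (B * D))" "s < dim_col (kronecker (A * C) (B * D))"
  then have rs: "r < n * p" "s < l * t"
    using assms by (auto simp: kronecker_def)
  have "(kronecker A B * kronecker C D) $$ (r, s)
      = (\<Sum>x<m * q. kronecker A B $$ (r, x) * kronecker C D $$ (x, s))"
    using rs kronecker_carrier[OF A B] kronecker_carrier[OF C D]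
    by (auto simp: scalar_prod_def lessThan_atLeast0)
  also have "\<dots> = (\<Sum>x<m * q. (A $$ (r div p, x div q) * C $$ (x div q, s div t)) *
      (B $$ (r mod p, x mod q) * D $$ (x mod q, s mod t)))"
    using rs by (intro sum.cong) (auto simp: index_kronecker[OF A B] index_kronecker[OF C D] mult_ac)
  also have "\<dots> = (\<Sum>i<m. A $$ (r div p, i) * C $$ (i, s div t)) *
      (\<Sum>k<q. B $$ (r mod p, k) * D $$ (k, s mod t))"
    by (subst sum_div_mod) (simp add: sum_product)
  also have "\<dots> = (A * C) $$ (r div p, s div t) * (B * D) $$ (r mod p, s mod t)"
    using assms div_mod_bounds[OF rs(1)] div_mod_bounds[OF rs(2)]
    by (auto simp: scalar_prod_def lessThan_atLeast0)
  also have "\<dots> = kronecker (A * C) (B * D) $$ (r, s)"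
    using assms rs by (subst index_kronecker[of _ n l _ p t]) auto
  finally show "(kronecker A B * kronecker C D) $$ (r, s) = kronecker (A * C) (B * D) $$ (r, s)" .
qed (use assms in \<open>auto simp: kronecker_def\<close>)

lemma kronecker_adjoint:
  fixes A B :: "complex mat"
  assumes A: "A \<in> carrier_mat n m" and B: "B \<in> carrier_mat p q"
  shows "mat_adjoint (kronecker A B) = kronecker (mat_adjoint A) (mat_adjoint B)"
proof (rule eq_matI)
  fix r s
  assume "r < dim_row (kronecker (mat_adjoint A) (mat_adjoint B))"
    "s < dim_col (kronecker (mat_adjoint A) (mat_adjoint B))"
  then have rs: "r < m * q" "s < n * p"
    using assms by (auto simp: kronecker_def)
  show "mat_adjoint (kronecker A B) $$ (r, s) = kronecker (mat_adjoint A) (mat_adjoint B) $$ (r, s)"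
    using assms rs div_mod_bounds[OF rs(1)] div_mod_bounds[OF rs(2)]
    by (simp add: index_mat_adjoint carrier_matD[OF kronecker_carrier[OF A B]] index_kronecker[OF A B]
      index_kronecker[of _ m n _ q p] carrier_matD[OF A] carrier_matD[OF B])
qed (use assms in \<open>auto simp: kronecker_def\<close>)

lemma kronecker_mat_diag:
  "kronecker (mat_diag n a) (mat_diag p b) = mat_diag (n * p) (\<lambda>r. a (r div p) * b (r mod p) :: complex)"
proof (rule eq_matI)
  fix r s
  assume "r < dim_row (mat_diag (n * p) (\<lambda>r. a (r div p) * b (r mod p)))"
    "s < dim_col (mat_diag (n * p) (\<lambda>r. a (r div p) * b (r mod p)))"
  then have rs: "r < n * p" "s < n * p"
    by (auto simp: mat_diag_def)
  have "r = s \<longleftrightarrow> r div p = s div p \<and> r mod p = s mod p"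
    by (metis div_mult_mod_eq)
  then show "kronecker (mat_diag n a) (mat_diag p b) $$ (r, s)
      = mat_diag (n * p) (\<lambda>r. a (r div p) * b (r mod p)) $$ (r, s)"
    using rs div_mod_bounds[OF rs(1)] div_mod_bounds[OF rs(2)]
    by (subst index_kronecker[of _ n n _ p p]) (auto simp: mat_diag_def)
qed (auto simp: kronecker_def mat_diag_def)

lemma kronecker_one: "kronecker (1\<^sub>m n) (1\<^sub>m p) = (1\<^sub>m (n * p) :: complex mat)"
  using kronecker_mat_diag[of n "\<lambda>_. 1" p "\<lambda>_. 1"] by simp

lemma unitary_kronecker:
  assumes U: "unitary n U" and V: "unitary p V"
  shows "unitary (n * p) (kronecker U V)"
proof (rule unitaryI)
  note Ud = unitaryD[OF U] and Vd = unitaryD[OF V]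
  show "kronecker U V \<in> carrier_mat (n * p) (n * p)"
    using Ud(1) Vd(1) by simp
  have "mat_adjoint (kronecker U V) * kronecker U V
      = kronecker (mat_adjoint U * U) (mat_adjoint V * V)"
    unfolding kronecker_adjoint[OF Ud(1) Vd(1)]
    using Ud(1) Vd(1) by (intro kronecker_mult[of _ n n _ n _ p p _ p]) auto
  then show "mat_adjoint (kronecker U V) * kronecker U V = 1\<^sub>m (n * p)"
    by (simp add: Ud(2) Vd(2) kronecker_one)
qed

lemma kronecker_unitary_conj:
  assumes U: "unitary n U" and V: "unitary p V"
    and M: "M \<in> carrier_mat n n" and N: "N \<in> carrier_mat p p"
  shows "kronecker (U * M * mat_adjoint U) (V * N * mat_adjoint V)
    = kronecker U V * kronecker M N * mat_adjoint (kronecker U V)"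
proof -
  note Ud = unitaryD(1)[OF U] and Vd = unitaryD(1)[OF V]
  have "kronecker U V * kronecker M N = kronecker (U * M) (V * N)"
    by (rule kronecker_mult[OF Ud M Vd N])
  moreover have "kronecker (U * M) (V * N) * kronecker (mat_adjoint U) (mat_adjoint V)
      = kronecker (U * M * mat_adjoint U) (V * N * mat_adjoint V)"
    using Ud Vd M N by (intro kronecker_mult[of _ n n _ n _ p p _ p]) auto
  ultimately show ?thesis
    by (simp add: kronecker_adjoint[OF Ud Vd])
qed

text \<open>Each identity factor is written as a conjugate of itself by the other unitary matrix.
  Both summands are then diagonalized by the same \<open>kronecker U V\<close>, and their diagonals
  add.\<close>

lemma kronecker_sum_unitary_diag:
  assumes U: "unitary n U" and V: "unitary p V"
    and A: "A = U * mat_diag n a * mat_adjoint U"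
    and B: "B = V * mat_diag p b * mat_adjoint V"
  shows "kronecker A (1\<^sub>m p) + kronecker (1\<^sub>m n) B = kronecker U V *
    mat_diag (n * p) (\<lambda>r. a (r div p) + b (r mod p)) * mat_adjoint (kronecker U V)"
proof -
  let ?W = "kronecker U V" and ?m = "n * p"
  note Ud = unitaryD[OF U] and Vd = unitaryD[OF V]
  let ?D = "mat_diag ?m (\<lambda>r. a (r div p))" and ?E = "mat_diag ?m (\<lambda>r. b (r mod p))"
  have W: "?W \<in> carrier_mat ?m ?m"
    using Ud(1) Vd(1) by simp
  have "kronecker A (1\<^sub>m p) = kronecker A (V * mat_diag p (\<lambda>_. 1) * mat_adjoint V)"
    using Vd by simp
  also have "\<dots> = ?W * ?D * mat_adjoint ?W"
    unfolding A using kronecker_mat_diag[of n a p "\<lambda>_. 1"]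
    by (subst kronecker_unitary_conj[OF U V]) auto
  finally have 1: "kronecker A (1\<^sub>m p) = ?W * ?D * mat_adjoint ?W" .
  have "kronecker (1\<^sub>m n) B = kronecker (U * mat_diag n (\<lambda>_. 1) * mat_adjoint U) B"
    using Ud by simp
  also have "\<dots> = ?W * ?E * mat_adjoint ?W"
    unfolding B using kronecker_mat_diag[of n "\<lambda>_. 1" p b]
    by (subst kronecker_unitary_conj[OF U V]) auto
  finally have 2: "kronecker (1\<^sub>m n) B = ?W * ?E * mat_adjoint ?W" .
  have "mat_diag ?m (\<lambda>r. a (r div p) + b (r mod p)) = ?D + ?E"
    by (rule eq_matI) (auto simp: mat_diag_def)
  then have "?W * mat_diag ?m (\<lambda>r. a (r div p) + b (r mod p)) * mat_adjoint ?W
      = (?W * ?D + ?W * ?E) * mat_adjoint ?W"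
    using mult_add_distrib_mat[OF W, of ?D ?m ?E] by simp
  also have "\<dots> = ?W * ?D * mat_adjoint ?W + ?W * ?E * mat_adjoint ?W"
    using W by (intro add_mult_distrib_mat[of _ ?m ?m]) auto
  finally show ?thesis
    unfolding 1 2 by simp
qed

text \<open>Expanding both products, the mixed terms agree on the two sides and cancel. What remains
  equates two Kronecker sums, which determine their summands up to a scalar matrix; equality of
  traces makes that scalar zero.\<close>

lemma normal_kronecker_sumD:
  assumes A: "A \<in> carrier_mat d d" and B: "B \<in> carrier_mat d d" and d: "d > 0"
    and normal: "normal_mat (kronecker A (1\<^sub>m d) + kronecker (1\<^sub>m d) B)"
  shows "normal_mat A" "normal_mat B"
proof -
  let ?I = "1\<^sub>m d :: complex mat" and ?m = "d * d"
  let ?X = "kronecker A ?I + kronecker ?I B"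
  let ?A' = "mat_adjoint A" and ?B' = "mat_adjoint B"
  have A': "?A' \<in> carrier_mat d d" and B': "?B' \<in> carrier_mat d d"
    using A B by auto
  have I: "?I \<in> carrier_mat d d"
    by simp
  have adj: "mat_adjoint ?X = kronecker ?A' ?I + kronecker ?I ?B'"
    using A B by (simp add: mat_adjoint_add[of _ ?m ?m] kronecker_adjoint[of _ d d _ d d])
  have expand: "(kronecker M ?I + kronecker ?I N) * (kronecker P ?I + kronecker ?I Q)
      = kronecker (M * P) ?I + kronecker P N + (kronecker M Q + kronecker ?I (N * Q))"
    if "M \<in> carrier_mat d d" "N \<in> carrier_mat d d" "P \<in> carrier_mat d d" "Q \<in> carrier_mat d d"
    for M N P Q
    using that by (simp add: add_mult_distrib_mat[of _ ?m ?m _ _ ?m] mult_add_distrib_mat[of _ ?m ?m _ ?m]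
      kronecker_mult[of _ d d _ d _ d d _ d])
  define P where "P = A * ?A'"
  define P' where "P' = ?A' * A"
  define Q where "Q = B * ?B'"
  define Q' where "Q' = ?B' * B"
  have c: "P \<in> carrier_mat d d" "P' \<in> carrier_mat d d" "Q \<in> carrier_mat d d" "Q' \<in> carrier_mat d d"
    using A B by (auto simp: P_def P'_def Q_def Q'_def)
  have eq: "kronecker P ?I + kronecker ?A' B + (kronecker A ?B' + kronecker ?I Q)
      = kronecker P' ?I + kronecker A ?B' + (kronecker ?A' B + kronecker ?I Q')"
    using normal unfolding normal_mat_def adj P_def P'_def Q_def Q'_def
    by (simp add: expand A B A' B')
  \<comment> \<open>The entry at row \<open>(i, k)\<close> and column \<open>(j, l)\<close>, after
    cancelling the mixed terms.\<close>
  have ent: "P $$ (i, j) * ?I $$ (k, l) + ?I $$ (i, j) * Q $$ (k, l)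
      = P' $$ (i, j) * ?I $$ (k, l) + ?I $$ (i, j) * Q' $$ (k, l)"
    if "i < d" "j < d" "k < d" "l < d" for i j k l
  proof -
    let ?r = "i * d + k" and ?s = "j * d + l"
    have rs: "?r < ?m" "?s < ?m"
      using that by (auto intro: mult_add_less_mult)
    have *: "kronecker M N $$ (?r, ?s) = M $$ (i, j) * N $$ (k, l)"
      "kronecker M N \<in> carrier_mat ?m ?m"
      if "M \<in> carrier_mat d d" "N \<in> carrier_mat d d" for M N :: "complex mat"
      using that \<open>k < d\<close> \<open>l < d\<close> index_kronecker[OF that rs] by auto
    show ?thesis
      using arg_cong[OF eq, of "\<lambda>X. X $$ (?r, ?s)"] rs
      by (simp add: *(1) A B A' B' c I
        carrier_matD[OF *(2)[OF c(1) I]] carrier_matD[OF *(2)[OF c(2) I]]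
        carrier_matD[OF *(2)[OF A B']] carrier_matD[OF *(2)[OF A' B]]
        carrier_matD[OF *(2)[OF I c(3)]] carrier_matD[OF *(2)[OF I c(4)]])
  qed
  have diag: "P $$ (i, i) + Q $$ (k, k) = P' $$ (i, i) + Q' $$ (k, k)" if "i < d" "k < d" for i k
    using ent[of i i k k] that by simp
  have "mat_trace P = mat_trace P'"
    using A A' unfolding P_def P'_def by (rule mat_trace_mult_commute)
  then have tr: "(\<Sum>i<d. P $$ (i, i)) = (\<Sum>i<d. P' $$ (i, i))"
    using c by (simp add: mat_trace_def)
  \<comment> \<open>By \<open>diag\<close> the difference of \<open>P\<close> and \<open>P'\<close>
    at \<open>(i, i)\<close> is independent of \<open>i\<close>. Summing over \<open>i\<close> for
    fixed \<open>k\<close>, the traces cancel and \<open>d\<close> times the difference of the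
    \<open>Q\<close> entries is zero.\<close>
  have Qkk: "Q $$ (k, k) = Q' $$ (k, k)" if "k < d" for k
  proof -
    have "(\<Sum>i<d. P $$ (i, i) + Q $$ (k, k)) = (\<Sum>i<d. P' $$ (i, i) + Q' $$ (k, k))"
      using diag that by (intro sum.cong) auto
    then show ?thesis
      using tr d by (simp add: sum.distrib)
  qed
  have "P = P'"
  proof (rule eq_matI)
    fix i j assume "i < dim_row P'" "j < dim_col P'"
    then show "P $$ (i, j) = P' $$ (i, j)"
      \<comment> \<open>Off the diagonal the factor \<open>?I $$ (i, j)\<close> removes the
        \<open>Q\<close> terms; on the diagonal they cancel by \<open>Qkk\<close>. Positivity of
        \<open>d\<close> makes 0 a valid index.\<close>
      using ent[of i j 0 0] diag[of i 0] Qkk[of 0] d c by (cases "i = j") auto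
  qed (use c in auto)
  then show "normal_mat A"
    using A by (auto simp: normal_mat_def P_def P'_def)
  have "Q = Q'"
  proof (rule eq_matI)
    fix k l assume "k < dim_row Q'" "l < dim_col Q'"
    then show "Q $$ (k, l) = Q' $$ (k, l)"
      using ent[of 0 0 k l] Qkk[of k] d c by (cases "k = l") auto
  qed (use c in auto)
  then show "normal_mat B"
    using B by (auto simp: normal_mat_def Q_def Q'_def)
qed

section \<open>The bound for two eigenvalues\<close>

text \<open>The sum over \<open>T\<close> is minus the sum over its complement, to which
  Cauchy-Schwarz applies. Thus a large partial sum forces mass on the remaining entries.\<close>

lemma norm_sum_complement_bound:
  fixes z :: "'b \<Rightarrow> complex"
  assumes "finite S" "T \<subseteq> S" "sum z S = 0"
  shows "(cmod (sum z T))\<^sup>2 \<le> real (card (S - T)) * (\<Sum>i\<in>S - T. (cmod (z i))\<^sup>2)"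
proof -
  have "sum z T = - sum z (S - T)"
    using assms by (simp add: sum_diff)
  then have "cmod (sum z T) \<le> (\<Sum>i\<in>S - T. cmod (z i))"
    by (simp add: norm_sum)
  then have "(cmod (sum z T))\<^sup>2 \<le> (\<Sum>i\<in>S - T. cmod (z i))\<^sup>2"
    by (intro power_mono) auto
  also have "\<dots> \<le> (\<Sum>i\<in>S - T. (cmod (z i))\<^sup>2) * real (card (S - T))"
    by (rule sum_squared_le_sum_of_squares)
  finally show ?thesis
    by (simp add: mult.commute)
qed

lemma norm_parallelogram:
  fixes u v :: complex
  shows "(cmod u)\<^sup>2 + (cmod v)\<^sup>2 = ((cmod (u + v))\<^sup>2 + (cmod (u - v))\<^sup>2) / 2"
  unfolding cmod_power2 by (simp add: power2_eq_square algebra_simps)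

text \<open>With \<open>s = b\<^sub>j + b\<^sub>l\<close> and \<open>t = b\<^sub>j - b\<^sub>l\<close> the left-hand side is \<open>(\<bar>2 a\<^sub>i + s\<bar>\<^sup>2 + \<bar>t\<bar>\<^sup>2) / 2\<close>.
  The zero-sum conditions force extra mass \<open>\<bar>a\<^sub>i\<bar>\<^sup>2 / (d - 1)\<close> and \<open>\<bar>s\<bar>\<^sup>2 / (d - 2)\<close> on the other
  entries, and \<open>(3 d - 4) / d\<^sup>2 \<le> 1 / 2\<close> amounts to \<open>(d - 2) (d - 4) \<ge> 0\<close>.\<close>

lemma shared_index_bound:
  fixes a b :: "nat \<Rightarrow> complex"
  assumes d: "d \<ge> 4" and sa: "(\<Sum>i<d. a i) = 0" and sb: "(\<Sum>i<d. b i) = 0"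
    and nrm: "(\<Sum>i<d. (cmod (a i))\<^sup>2) + (\<Sum>i<d. (cmod (b i))\<^sup>2) = 1 / real d"
    and ij: "i < d" "j < d" "l < d" "j \<noteq> l"
  shows "(cmod (a i + b j))\<^sup>2 + (cmod (a i + b l))\<^sup>2 \<le> 1 / 2"
proof -
  define N where "N = real d"
  define x where "x = cmod (a i)"
  define y where "y = cmod (b j + b l)"
  define t where "t = cmod (b j - b l)"
  define Sa where "Sa = (\<Sum>i<d. (cmod (a i))\<^sup>2)"
  define Sb where "Sb = (\<Sum>i<d. (cmod (b i))\<^sup>2)"
  have N: "N \<ge> 4"
    using d by (simp add: N_def)
  have "(cmod (a i + b j))\<^sup>2 + (cmod (a i + b l))\<^sup>2
      = ((cmod (2 * a i + (b j + b l)))\<^sup>2 + t\<^sup>2) / 2"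
    by (subst norm_parallelogram) (simp add: t_def algebra_simps)
  also have "cmod (2 * a i + (b j + b l)) \<le> 2 * x + y"
    unfolding x_def y_def by (rule order_trans[OF norm_triangle_ineq]) (simp add: norm_mult)
  then have "((cmod (2 * a i + (b j + b l)))\<^sup>2 + t\<^sup>2) / 2 \<le> ((2 * x + y)\<^sup>2 + t\<^sup>2) / 2"
    by (intro divide_right_mono add_right_mono power_mono) auto
  finally have main: "(cmod (a i + b j))\<^sup>2 + (cmod (a i + b l))\<^sup>2 \<le> ((2 * x + y)\<^sup>2 + t\<^sup>2) / 2" .
  have "x\<^sup>2 \<le> (N - 1) * (Sa - x\<^sup>2)"
  proof -
    have "(\<Sum>k\<in>{..<d} - {i}. (cmod (a k))\<^sup>2) = Sa - x\<^sup>2"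
      using ij by (simp add: Sa_def x_def sum_diff1)
    moreover have "real (card ({..<d} - {i})) = N - 1"
      using ij by (simp add: N_def)
    ultimately show ?thesis
      using norm_sum_complement_bound[of "{..<d}" "{i}" a] ij sa by (simp add: x_def)
  qed
  then have xa: "x\<^sup>2 / (N - 1) \<le> Sa / N"
    using N by (simp add: field_simps)
  have "y\<^sup>2 \<le> (N - 2) * (Sb - (y\<^sup>2 + t\<^sup>2) / 2)"
  proof -
    have "(\<Sum>k\<in>{..<d} - {j, l}. (cmod (b k))\<^sup>2) = Sb - ((cmod (b j))\<^sup>2 + (cmod (b l))\<^sup>2)"
      using ij by (subst sum_diff) (auto simp: Sb_def)
    also have "\<dots> = Sb - (y\<^sup>2 + t\<^sup>2) / 2"
      by (simp add: norm_parallelogram[of "b j"] y_def t_def)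
    finally have 1: "(\<Sum>k\<in>{..<d} - {j, l}. (cmod (b k))\<^sup>2) = Sb - (y\<^sup>2 + t\<^sup>2) / 2" .
    have "card ({..<d} - {j, l}) = d - 2"
      using ij by (subst card_Diff_subset) auto
    then have 2: "real (card ({..<d} - {j, l})) = N - 2"
      using d by (simp add: N_def)
    show ?thesis
      using norm_sum_complement_bound[of "{..<d}" "{j, l}" b] ij sb unfolding 1 2
      by (simp add: y_def)
  qed
  \<comment> \<open>Collecting the \<open>y\<close> terms gives the coefficient 1 + (N - 2) / 2 = N
    / 2 on the left.\<close>
  then have yb: "y\<^sup>2 / (2 * (N - 2)) \<le> (Sb - t\<^sup>2 / 2) / N"
    using N by (simp add: field_simps)
  \<comment> \<open>Cauchy-Schwarz with weights N - 1 and 2 (N - 2), chosen to match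
    \<open>xa\<close> and \<open>yb\<close>. The constant is half of 4 (N - 1) + 2 (N - 2) = 2 (3 N
    - 4), and the defect is an explicit square.\<close>
  have cs: "(2 * x + y)\<^sup>2 / 2 \<le> (3 * N - 4) * (x\<^sup>2 / (N - 1) + y\<^sup>2 / (2 * (N - 2)))"
  proof -
    have "(3 * N - 4) * (x\<^sup>2 / (N - 1) + y\<^sup>2 / (2 * (N - 2))) - (2 * x + y)\<^sup>2 / 2
        = ((N - 2) * x - (N - 1) * y)\<^sup>2 / ((N - 1) * (N - 2))"
      using N by (simp add: divide_simps) (simp add: power2_eq_square algebra_simps)
    also have "\<dots> \<ge> 0"
      using N by simp
    finally show ?thesis
      by simp
  qed
  also have "\<dots> \<le> (3 * N - 4) * ((Sa + Sb - t\<^sup>2 / 2) / N)"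
    using xa yb N by (intro mult_left_mono) (auto simp: add_divide_distrib diff_divide_distrib)
  also have "Sa + Sb = 1 / N"
    using nrm by (simp add: Sa_def Sb_def N_def)
  finally have "((2 * x + y)\<^sup>2 + t\<^sup>2) / 2 \<le> (3 * N - 4) * ((1 / N - t\<^sup>2 / 2) / N) + t\<^sup>2 / 2"
    by (simp add: add_divide_distrib)
  \<comment> \<open>The total coefficient of the square of \<open>t\<close> is negative, so the
    bound is largest at t = 0.\<close>
  also have "\<dots> = (3 * N - 4) / N\<^sup>2 - (N - 2) / N * t\<^sup>2"
    using N by (simp add: divide_simps) (simp add: power2_eq_square algebra_simps)
  also have "\<dots> \<le> (3 * N - 4) / N\<^sup>2"
    using N by simp
  also have "\<dots> \<le> 1 / 2"
  proof -
    have "0 \<le> (N - 2) * (N - 4)"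
      using N by simp
    also have "\<dots> = N * N + 8 - N * 6"
      by (simp add: algebra_simps)
    finally show ?thesis
      using N by (simp add: divide_simps) (simp add: power2_eq_square algebra_simps)
  qed
  finally show ?thesis
    using main by simp
qed

text \<open>Each squared modulus of a sum is at most twice the sum of the squared moduli. No entry
  of \<open>a\<close> or \<open>b\<close> is used twice, so the total is at most 2 / d.\<close>

lemma distinct_indices_bound:
  fixes a b :: "nat \<Rightarrow> complex"
  assumes d: "d \<ge> 4"
    and nrm: "(\<Sum>i<d. (cmod (a i))\<^sup>2) + (\<Sum>i<d. (cmod (b i))\<^sup>2) = 1 / real d"
    and ij: "i < d" "k < d" "i \<noteq> k" "j < d" "l < d" "j \<noteq> l"
  shows "(cmod (a i + b j))\<^sup>2 + (cmod (a k + b l))\<^sup>2 \<le> 1 / 2"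
proof -
  have sq: "(cmod (u + v))\<^sup>2 \<le> 2 * ((cmod u)\<^sup>2 + (cmod v)\<^sup>2)" for u v
  proof -
    have "2 * ((cmod u)\<^sup>2 + (cmod v)\<^sup>2) = (cmod (u + v))\<^sup>2 + (cmod (u - v))\<^sup>2"
      using norm_parallelogram[of u v] by simp
    then show ?thesis
      by simp
  qed
  have two: "(cmod (z p))\<^sup>2 + (cmod (z q))\<^sup>2 \<le> (\<Sum>i<d. (cmod (z i))\<^sup>2)"
    if "p < d" "q < d" "p \<noteq> q" for z :: "nat \<Rightarrow> complex" and p q
    using sum_mono2[of "{..<d}" "{p, q}" "\<lambda>i. (cmod (z i))\<^sup>2"] that by simp
  have "(cmod (a i + b j))\<^sup>2 + (cmod (a k + b l))\<^sup>2
      \<le> 2 * ((cmod (a i))\<^sup>2 + (cmod (a k))\<^sup>2) + 2 * ((cmod (b j))\<^sup>2 + (cmod (b l))\<^sup>2)"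
    using add_mono[OF sq[of "a i" "b j"] sq[of "a k" "b l"]] by (simp add: algebra_simps)
  also have "\<dots> \<le> 2 * (\<Sum>i<d. (cmod (a i))\<^sup>2) + 2 * (\<Sum>i<d. (cmod (b i))\<^sup>2)"
    using two[OF ij(1-3), of a] two[OF ij(4-6), of b] by (intro add_mono mult_left_mono) auto
  also have "\<dots> = 2 * (1 / real d)"
    unfolding nrm[symmetric] by simp
  also have "\<dots> \<le> 1 / 2"
    using d by (simp add: field_simps)
  finally show ?thesis .
qed

lemma two_eigenvalues_bound:
  fixes a b :: "nat \<Rightarrow> complex"
  assumes d: "d \<ge> 4" and sa: "(\<Sum>i<d. a i) = 0" and sb: "(\<Sum>i<d. b i) = 0"
    and nrm: "(\<Sum>i<d. (cmod (a i))\<^sup>2) + (\<Sum>i<d. (cmod (b i))\<^sup>2) = 1 / real d"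
    and ij: "i < d" "j < d" "k < d" "l < d" "(i, j) \<noteq> (k, l)"
  shows "(cmod (a i + b j))\<^sup>2 + (cmod (a k + b l))\<^sup>2 \<le> 1 / 2"
proof -
  consider "i = k" "j \<noteq> l" | "j = l" "i \<noteq> k" | "i \<noteq> k" "j \<noteq> l"
    using ij by auto
  then show ?thesis
  proof cases
    case 1
    then show ?thesis
      using shared_index_bound[OF d sa sb nrm, of i j l] ij by simp
  next
    \<comment> \<open>Symmetric to the first case, with the roles of \<open>a\<close> and
      \<open>b\<close> exchanged.\<close>
    case 2
    then show ?thesis
      using shared_index_bound[OF d sb sa, of j i k] nrm ij by (simp add: add.commute)
  next
    case 3
    then show ?thesis
      using distinct_indices_bound[OF d nrm, of i k j l] ij by simp
  qed
qed

section \<open>From eigenvalue pairs to the two largest singular values\<close>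

theorem lemma10:
  fixes d :: nat and A B X :: "complex mat"
  assumes d: "d > 4"
    and A: "A \<in> carrier_mat d d"
    and B: "B \<in> carrier_mat d d"
    and trA: "mat_trace A = 0"
    and trB: "mat_trace B = 0"
    and norm: "mat_trace (mat_adjoint A * A) + mat_trace (mat_adjoint B * B) = 1 / of_nat d"
    and X: "X = kronecker A (1\<^sub>m d) + kronecker (1\<^sub>m d) B"
    and normal: "normal_mat X"
  shows "(singular_values X ! 0)\<^sup>2 + (singular_values X ! 1)\<^sup>2 \<le> 1 / 2"
proof -
  have "normal_mat A" "normal_mat B"
    using normal_kronecker_sumD[OF A B] d normal unfolding X by auto
  then obtain U a V b where U: "unitary d U" and Aa: "A = U * mat_diag d a * mat_adjoint U"
    and V: "unitary d V" and Bb: "B = V * mat_diag d b * mat_adjoint V"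
    using normal_mat_unitary_diag[OF A] normal_mat_unitary_diag[OF B] by blast
  have tr_diag: "mat_trace (mat_diag d f) = (\<Sum>i<d. f i)" for f :: "nat \<Rightarrow> complex"
    by (simp add: mat_trace_def mat_diag_def)
  have tr: "mat_trace (W * mat_diag d f * mat_adjoint W) = (\<Sum>i<d. f i)"
    if "unitary d W" for W and f :: "nat \<Rightarrow> complex"
    using that by (simp add: mat_trace_unitary_conj tr_diag)
  have tr_sq: "mat_trace (mat_adjoint M * M) = of_real (\<Sum>i<d. (cmod (f i))\<^sup>2)"
    if "unitary d W" "M = W * mat_diag d f * mat_adjoint W" for W M f
  proof -
    have "mat_adjoint M * M = W * mat_diag d (\<lambda>i. cnj (f i) * f i) * mat_adjoint W"
      unfolding that(2)
      by (simp add: adjoint_unitary_conj[OF that(1)] mat_adjoint_diag unitary_conj_mult[OF that(1)])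
    then show ?thesis
      by (simp add: tr[OF that(1)] complex_norm_square mult.commute del: of_real_power)
  qed
  have sa: "(\<Sum>i<d. a i) = 0" and sb: "(\<Sum>i<d. b i) = 0"
    using trA trB unfolding Aa Bb tr[OF U] tr[OF V] by auto
  have "complex_of_real ((\<Sum>i<d. (cmod (a i))\<^sup>2) + (\<Sum>i<d. (cmod (b i))\<^sup>2)) = of_real (1 / real d)"
    using norm unfolding tr_sq[OF U Aa] tr_sq[OF V Bb] by simp
  then have nrm: "(\<Sum>i<d. (cmod (a i))\<^sup>2) + (\<Sum>i<d. (cmod (b i))\<^sup>2) = 1 / real d"
    unfolding of_real_eq_iff .
  define g where "g r = cmod (a (r div d) + b (r mod d))" for r
  have "mset (singular_values X) = mset (map g [0..<d * d])"
    unfolding g_def X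
    by (rule singular_values_unitary_diag[OF unitary_kronecker[OF U V]
      kronecker_sum_unitary_diag[OF U V Aa Bb]])
  \<comment> \<open>Equal multisets give a bijection between positions. Which eigenvalues are
    largest need not be known: positions 0 and 1 come from distinct indices, hence from distinct
    pairs, and the bound holds for all such pairs.\<close>
  then obtain \<pi> where \<pi>: "bij_betw \<pi> {..<length (singular_values X)} {..<length (map g [0..<d * d])}"
    and sv: "\<forall>i<length (singular_values X). singular_values X ! i = map g [0..<d * d] ! \<pi> i"
    using permutation_Ex_bij by metis
  have len: "length (singular_values X) = d * d"
    using B by (simp add: length_singular_values X kronecker_def)
  have "1 < d * d"
    using d by (metis less_1_mult less_trans one_less_numeral_iff semiring_norm(76))
  then have dd: "0 < d * d" "1 < d * d"
    using d by auto
  have \<pi>d: "\<pi> 0 < d * d" "\<pi> 1 < d * d"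
    using bij_betw_apply[OF \<pi>] dd by (auto simp: len)
  have "\<pi> 0 \<noteq> \<pi> 1"
    using bij_betw_imp_inj_on[OF \<pi>] dd by (auto simp: len inj_on_def)
  then have "(\<pi> 0 div d, \<pi> 0 mod d) \<noteq> (\<pi> 1 div d, \<pi> 1 mod d)"
    by (metis div_mult_mod_eq prod.inject)
  then have "(g (\<pi> 0))\<^sup>2 + (g (\<pi> 1))\<^sup>2 \<le> 1 / 2"
    unfolding g_def using d div_mod_bounds[OF \<pi>d(1)] div_mod_bounds[OF \<pi>d(2)]
    by (intro two_eigenvalues_bound[OF _ sa sb nrm]) auto
  then show ?thesis
    using sv dd \<pi>d by (simp add: len)
qed

end
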